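(* Let $n\ge2$, let $q$ be a prime power and $\mathbb{V}_0=\mathbb{F}_q^n$. For the graph $\mathbf{SIG}(\mathbb{V}_0)$ the following statements hold: (1) $\deg(\langle M\rangle)=\sum_{\lambda\in \mathrm{Spec}(M)}\frac{q^{d_\lambda}-1}{q-1}$ and $1\le\deg(\langle M\rangle)\le\frac{q^n-1}{q-1}$, for every matrix $M\in E_n(\mathbb{F}_q)$. (2) For every $\langle v\rangle\in\mathbb{P}^{n-1}(\mathbb{F}_q)$, $\deg(\langle v\rangle)=\frac{q^{n^2-n+1}-1}{q-1}$. (3) $\Delta(\mathbf{SIG}(\mathbb{V}_0))=\frac{q^{n^2-n+1}-1}{q-1}$ and $\delta(\mathbf{SIG}(\mathbb{V}_0))=1$.
   Context: $\mathbb{F}_q$ is the finite field with $q$ elements and $\mathbb{V}_0=\mathbb{F}_q^n$ is the space of column vectors. $E_n(\mathbb{F}_q)$ is the set of nonzero matrices $M\in M_n(\mathbb{F}_q)$ having at least one eigenvector in $\mathbb{V}_0$ (a nonzero $v$ with $Mv=\lambda v$ for some $\lambda\in\mathbb{F}_q$; $\lambda=0$ allowed). $\mathcal{E}^{n-1}(\mathbb{F}_q)=\{\langle M\rangle: M\in E_n(\mathbb{F}_q)\}$ is the set of one-dimensional subspaces of $M_n(\mathbb{F}_q)$ generated by elements of $E_n(\mathbb{F}_q)$, and $\mathbb{P}^{n-1}(\mathbb{F}_q)$ is the set of one-dimensional subspaces $\langle v\rangle$ of $\mathbb{V}_0$. The spectral incidence graph $\mathbf{SIG}(\mathbb{V}_0)$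 is the simple bipartite graph with vertex set the disjoint union $\mathcal{E}^{n-1}(\mathbb{F}_q)\cup\mathbb{P}^{n-1}(\mathbb{F}_q)$ in which $\langle M\rangle$ and $\langle v\rangle$ are adjacent iff $v$ is an eigenvector of $M$. $\mathrm{Spec}(M)=\{\lambda\in\mathbb{F}_q:\det(M-\lambda I_n)=0\}$ and $d_\lambda=\dim\ker(M-\lambda I_n)$. $\deg$ is the vertex degree; $\Delta$ and $\delta$ are the maximum and minimum degree of the graph. *)

theory Defs
  imports "HOL-Analysis.Analysis"
begin

subsection \<open>Matrices and eigenvectors\<close>

text \<open>\<^term>\<open>c *s M\<close> would treat \<open>M\<close> as a vector whose entries are rows, so that \<open>c\<close> itself
  would have to be a row. The matrix space needs its own scalar multiplication.\<close>

definition matrix_scale :: "'a::times \<Rightarrow> 'a ^ 'n ^ 'm \<Rightarrow> 'a ^ 'n ^ 'm" (infixr "*\<^sub>M" 75) where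
  "c *\<^sub>M M = (\<chi> i j. c * M $ i $ j)"

interpretation matspace: vector_space "(*\<^sub>M) :: 'a::field \<Rightarrow> 'a ^ 'n ^ 'm \<Rightarrow> 'a ^ 'n ^ 'm"
  by unfold_locales (simp_all add: matrix_scale_def vec_eq_iff algebra_simps)

definition eigenvector :: "'a::field ^ 'n ^ 'n \<Rightarrow> 'a ^ 'n \<Rightarrow> bool" where
  "eigenvector M v \<longleftrightarrow> v \<noteq> 0 \<and> (\<exists>c. M *v v = c *s v)"

definition Spec :: "'a::field ^ 'n ^ 'n \<Rightarrow> 'a set" where
  "Spec M = {c. det (M - mat c) = 0}"

definition eigendim :: "'a::field ^ 'n ^ 'n \<Rightarrow> 'a \<Rightarrow> nat" where
  "eigendim M c = vec.dim {v. (M - mat c) *v v = 0}"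

definition eigmats :: "('a::field ^ 'n ^ 'n) set" where
  "eigmats = {M. M \<noteq> 0 \<and> (\<exists>v. eigenvector M v)}"

definition eiglines :: "('a::field ^ 'n ^ 'n) set set" where
  "eiglines = {matspace.span {M} | M. M \<in> eigmats}"

definition projspace :: "('a::field ^ 'n) set set" where
  "projspace = {vec.span {v} | v. v \<noteq> 0}"

subsection \<open>Simple graphs\<close>

text \<open>A graph is a pair of a vertex set and a set of unordered edges.\<close>

type_synonym 'v sgraph = "'v set \<times> 'v set set"

definition simple_graph :: "'v sgraph \<Rightarrow> bool" where
  "simple_graph G \<longleftrightarrow> (\<forall>e \<in> snd G. e \<subseteq> fst G \<and> card e = 2)"

definition vdegree :: "'v sgraph \<Rightarrow> 'v \<Rightarrow> nat" where
  "vdegree G x = card {e \<in> snd G. x \<in> e}"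

definition max_degree :: "'v sgraph \<Rightarrow> nat" where
  "max_degree G = Max (vdegree G ` fst G)"

definition min_degree :: "'v sgraph \<Rightarrow> nat" where
  "min_degree G = Min (vdegree G ` fst G)"

subsection \<open>The spectral incidence graph\<close>

text \<open>The type argument plays the role of the space of column vectors.\<close>

definition SIG ::
  "('a::field ^ 'n) itself \<Rightarrow> (('a ^ 'n ^ 'n) set + ('a ^ 'n) set) sgraph" where
  "SIG V0 =
    (eiglines <+> projspace,
     {{Inl (matspace.span {M}), Inr (vec.span {v})} | M v. M \<in> eigmats \<and> eigenvector M v})"

text \<open>Adjacency does not depend on the chosen generators.\<close>

lemma matrix_scale_mult_vec: "(c *\<^sub>M M) *v v = c *s (M *v v)"
  for M :: "'a::field ^ 'n ^ 'm"
  by (simp add: matrix_scale_def matrix_vector_mult_def vec_eq_iff sum_distrib_left mult.assoc)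

lemma eigenvector_span_cong:
  assumes M: "matspace.span {M} = matspace.span {M'}"
    and v: "vec.span {v} = vec.span {v'}" and ev: "eigenvector M v"
  shows "eigenvector M' v'"
proof -
  obtain a where a: "M' = a *\<^sub>M M"
    using matspace.span_base[of M' "{M'}"] M by (auto simp: matspace.span_singleton)
  obtain b where b: "v' = b *s v"
    using vec.span_base[of v' "{v'}"] v by (auto simp: vec.span_singleton)
  obtain c where c: "v = c *s v'"
    using vec.span_base[of v "{v}"] v by (auto simp: vec.span_singleton)
  obtain l where l: "M *v v = l *s v"
    using ev by (auto simp: eigenvector_def)
  have "v' \<noteq> 0" using ev c by (auto simp: eigenvector_def)
  moreover have "M' *v v' = (a * l) *s v'"
    by (simp add: a b matrix_scale_mult_vec vector_scalar_commute l
        vector_smult_assoc mult_ac del: vec.scale_scale)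
  ultimately show ?thesis by (auto simp: eigenvector_def)
qed

lemma SIG_adjacent_iff:
  fixes M :: "'a::field ^ 'n ^ 'n" and v :: "'a ^ 'n"
  assumes "M \<in> eigmats"
  shows "{Inl (matspace.span {M}), Inr (vec.span {v})} \<in> snd (SIG TYPE('a ^ 'n))
    \<longleftrightarrow> eigenvector M v"
proof
  assume "{Inl (matspace.span {M}), Inr (vec.span {v})} \<in> snd (SIG TYPE('a ^ 'n))"
  then obtain M' v' where "matspace.span {M'} = matspace.span {M}"
    "vec.span {v'} = vec.span {v}" "eigenvector M' v'"
    by (auto simp: SIG_def doubleton_eq_iff)
  then show "eigenvector M v" by (rule eigenvector_span_cong)
qed (use assms in \<open>auto simp: SIG_def\<close>)

lemma simple_graph_SIG: "simple_graph (SIG V0)"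
  by (auto simp: simple_graph_def SIG_def eiglines_def projspace_def eigenvector_def)

end

theory Submission
  imports Defs
begin

text \<open>
  The degree of a vertex counts the lines contained in a set of vectors, respectively matrices,
  that is closed under nonzero scaling. Every line has \<open>q\<close> elements, so such a set splits into
  blocks of \<open>q - 1\<close> nonzero multiples, one block for each line
  (\<open>card_lines_of_scaling_closed\<close>), and each degree is a number of elements divided by \<open>q - 1\<close>.

  For a matrix vertex the set consists of the eigenvectors of \<open>M\<close>. Eigenspaces for different
  eigenvalues meet only in \<open>0\<close>, and a subspace of dimension \<open>d\<close> has \<open>q ^ d\<close> elements, which gives the
  sum over the spectrum (\<open>card_eigenvectors\<close>). The bounds hold because \<open>M\<close> has some eigenvector and
  all eigenvectors are among the \<open>q ^ n - 1\<close> nonzero vectors.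

  For a point vertex the set consists of the nonzero matrices that send \<open>v\<close> into its own line.
  The map \<open>M \<mapsto> M *v v\<close> is additive and onto, so all its fibres have
  \<open>q ^ (n\<^sup>2 - n)\<close> elements; the line through \<open>v\<close> has \<open>q\<close> points, and the fibres above it contain
  \<open>q ^ (n\<^sup>2 - n + 1)\<close> matrices, one of which is zero (\<open>card_matrices_with_eigenvector\<close>).

  Since \<open>n \<le> n\<^sup>2 - n + 1\<close>, the maximum degree is the one attained at the points. The
  minimum is \<open>1\<close>, because a single nilpotent Jordan block has exactly one eigenline
  (\<open>ex_matrix_unique_eigenline\<close>).
\<close>

section \<open>Counting lines over a finite field\<close>

lemma (in vector_space) span_singleton_cong:
  assumes "u \<in> span {v}" "u \<noteq> 0"
  shows "span {u} = span {v}"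
proof -
  obtain c where c: "u = c *s v"
    using assms(1) by (auto simp: span_singleton)
  then have "c \<noteq> 0"
    using assms(2) by auto
  then have "v = inverse c *s u"
    by (simp add: c)
  then have "v \<in> span {u}"
    by (metis span_base span_scale singletonI)
  then show ?thesis
    using assms(1) by (simp add: span_eq)
qed

lemma (in vector_space) card_span_singleton:
  assumes "v \<noteq> 0"
  shows "card (span {v}) = card (UNIV :: 'a set)"
proof -
  have "inj (\<lambda>c. c *s v)"
    using assms by (auto intro!: injI)
  then show ?thesis
    by (simp add: span_singleton card_image)
qed

text \<open>The sets \<open>span {u} - {0}\<close> with \<open>u \<in> U\<close> partition \<open>U\<close>: closure under nonzero scaling puts
  them inside \<open>U\<close>, and any nonzero element of a line spans it, so distinct lines share only \<open>0\<close>.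
  This one count serves vectors and matrices alike.\<close>

lemma (in vector_space) card_lines_of_scaling_closed:
  fixes U :: "'b set"
  assumes U: "finite U" "0 \<notin> U"
    and scale: "\<And>c u. u \<in> U \<Longrightarrow> c \<noteq> 0 \<Longrightarrow> c *s u \<in> U"
  shows "(card (UNIV :: 'a set) - 1) * card ((\<lambda>u. span {u}) ` U) = card U"
proof -
  let ?L = "(\<lambda>u. span {u}) ` U"
  let ?C = "(\<lambda>l. l - {0}) ` ?L"
  have sub: "span {u} - {0} \<subseteq> U" if "u \<in> U" for u
    using scale[OF that] by (fastforce simp: span_singleton)
  have un: "\<Union> ?C = U"
    using sub U(2) by (force intro: span_base)
  have inj: "inj_on (\<lambda>l. l - {0}) ?L"
    by (rule inj_onI) (metis (no_types, lifting) imageE insert_Diff span_zero)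
  have card: "card d = card (UNIV :: 'a set) - 1" if "d \<in> ?C" for d
  proof -
    obtain u where u: "u \<in> U" "d = span {u} - {0}"
      using \<open>d \<in> ?C\<close> by blast
    then have "u \<noteq> 0"
      using U(2) by blast
    then show ?thesis
      using u(2) by (simp add: card_Diff_singleton span_zero card_span_singleton)
  qed
  have disj: "d \<inter> d' = {}" if "d \<in> ?C" "d' \<in> ?C" "d \<noteq> d'" for d d'
  proof (rule ccontr)
    assume "d \<inter> d' \<noteq> {}"
    then obtain w where "w \<in> d" "w \<in> d'"
      by blast
    with that(1,2) have "d = span {w} - {0}" "d' = span {w} - {0}"
      by (auto dest: span_singleton_cong)
    with that(3) show False
      by simp
  qed
  have "(card (UNIV :: 'a set) - 1) * card ?C = card (\<Union> ?C)"
    by (rule card_partition) (use U un card disj in auto)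
  then show ?thesis
    by (simp only: un card_image[OF inj])
qed

text \<open>Adjoining an independent vector \<open>b\<close> multiplies the number of elements by that of the field,
  since \<open>(c, x) \<mapsto> c *s b + x\<close> is a bijection onto the larger span.
  Over an infinite field both sides are \<open>0\<close> unless \<open>B\<close> is empty, as \<open>card\<close> is \<open>0\<close> on infinite sets.\<close>

lemma (in vector_space) card_span_independent:
  assumes "finite B" "independent B"
  shows "card (span B) = card (UNIV :: 'a set) ^ card B"
  using assms
proof (induction B)
  case empty
  then show ?case by simp
next
  case (insert b B)
  then have b: "b \<notin> span B" and B: "independent B"
    by (auto simp: independent_insert)
  let ?f = "\<lambda>(c, x). c *s b + x"
  have "span (insert b B) = ?f ` (UNIV \<times> span B)"
  proof (intro equalityI subsetI)
    fix x assume "x \<in> span (insert b B)"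
    then obtain c where "x - c *s b \<in> span B"
      by (auto simp: span_insert)
    then show "x \<in> ?f ` (UNIV \<times> span B)"
      by (intro image_eqI[of _ _ "(c, x - c *s b)"]) auto
  next
    fix x assume "x \<in> ?f ` (UNIV \<times> span B)"
    then obtain c y where "x = c *s b + y" "y \<in> span B"
      by auto
    then show "x \<in> span (insert b B)"
      by (auto simp: span_insert intro!: exI[of _ c])
  qed
  moreover have "inj_on ?f (UNIV \<times> span B)"
  proof (rule inj_onI, clarsimp)
    fix c x d y
    assume xy: "x \<in> span B" "y \<in> span B" and eq: "c *s b + x = d *s b + y"
    have "(c - d) *s b = y - x"
      using eq by (simp add: scale_left_diff_distrib algebra_simps)
    then have "(c - d) *s b \<in> span B"
      using xy by (simp add: span_diff)
    then have "inverse (c - d) *s ((c - d) *s b) \<in> span B"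
      by (rule span_scale)
    then have "c = d"
      using b by (cases "c = d") auto
    then show "c = d \<and> x = y"
      using eq by simp
  qed
  ultimately have "card (span (insert b B)) = card (UNIV :: 'a set) * card (span B)"
    by (simp add: card_image card_cartesian_product)
  then show ?case
    using insert.IH[OF B] insert.hyps by simp
qed

lemma (in finite_dimensional_vector_space) card_subspace:
  assumes "subspace S"
  shows "card S = card (UNIV :: 'a set) ^ dim S"
proof -
  obtain B where "finite B" "independent B" "span B = S" "card B = dim S"
    using basis_subspace_exists[OF assms] .
  then show ?thesis
    using card_span_independent by metis
qed

section \<open>Degrees in the spectral incidence graph\<close>

text \<open>Edges are unordered pairs of lines, given by arbitrary generators. An edge at a fixed vertex
  is determined by its other end, and being an eigenvector depends only on the two lines
  (\<open>eigenvector_span_cong\<close>), so the incident edges may be counted as lines through eigenvectors of one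
  fixed generator.\<close>

lemma vdegree_SIG_matrix:
  fixes M :: "'a::field ^ 'n ^ 'n"
  assumes "M \<in> eigmats"
  shows "vdegree (SIG TYPE('a ^ 'n)) (Inl (matspace.span {M}))
    = card ((\<lambda>v. vec.span {v}) ` {v. eigenvector M v})"
proof -
  let ?e = "\<lambda>l. {Inl (matspace.span {M}), Inr l} :: (('a ^ 'n ^ 'n) set + ('a ^ 'n) set) set"
  have "{e \<in> snd (SIG TYPE('a ^ 'n)). Inl (matspace.span {M}) \<in> e}
    = ?e ` (\<lambda>v. vec.span {v}) ` {v. eigenvector M v}"
  proof (intro equalityI subsetI)
    fix e assume "e \<in> {e \<in> snd (SIG TYPE('a ^ 'n)). Inl (matspace.span {M}) \<in> e}"
    then obtain M' v where e: "e = {Inl (matspace.span {M'}), Inr (vec.span {v})}"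
      "eigenvector M' v" "matspace.span {M} = matspace.span {M'}"
      by (auto simp: SIG_def)
    then have "eigenvector M v"
      using eigenvector_span_cong[of M' M v v] by simp
    with e show "e \<in> ?e ` (\<lambda>v. vec.span {v}) ` {v. eigenvector M v}"
      by auto
  qed (use assms in \<open>auto simp: SIG_def\<close>)
  moreover have "inj ?e"
    by (rule injI) (auto simp: doubleton_eq_iff)
  ultimately show ?thesis
    by (simp add: vdegree_def card_image inj_on_subset)
qed

lemma vdegree_SIG_point:
  fixes v :: "'a::field ^ 'n"
  shows "vdegree (SIG TYPE('a ^ 'n)) (Inr (vec.span {v}))
    = card ((\<lambda>M. matspace.span {M}) ` {M. M \<noteq> 0 \<and> eigenvector M v})"
proof -
  let ?e = "\<lambda>l. {Inl l, Inr (vec.span {v})} :: (('a ^ 'n ^ 'n) set + ('a ^ 'n) set) set"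
  have "{e \<in> snd (SIG TYPE('a ^ 'n)). Inr (vec.span {v}) \<in> e}
    = ?e ` (\<lambda>M. matspace.span {M}) ` {M. M \<noteq> 0 \<and> eigenvector M v}"
  proof (intro equalityI subsetI)
    fix e assume "e \<in> {e \<in> snd (SIG TYPE('a ^ 'n)). Inr (vec.span {v}) \<in> e}"
    then obtain M w where e: "e = {Inl (matspace.span {M}), Inr (vec.span {w})}"
      "M \<in> eigmats" "eigenvector M w" "vec.span {v} = vec.span {w}"
      by (auto simp: SIG_def)
    then have "eigenvector M v" "M \<noteq> 0"
      using eigenvector_span_cong[of M M w v] by (auto simp: eigmats_def)
    with e show "e \<in> ?e ` (\<lambda>M. matspace.span {M}) ` {M. M \<noteq> 0 \<and> eigenvector M v}"
      by auto
  qed (auto simp: SIG_def eigmats_def)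
  moreover have "inj ?e"
    by (rule injI) (auto simp: doubleton_eq_iff)
  ultimately show ?thesis
    by (simp add: vdegree_def card_image inj_on_subset)
qed

subsection \<open>Matrix vertices\<close>

lemma mat_mult_vec: "mat c *v x = c *s x" for x :: "'a::field ^ 'n"
proof -
  have "mat c = c *\<^sub>M (mat 1 :: 'a ^ 'n ^ 'n)"
    by (simp add: matrix_scale_def mat_def vec_eq_iff)
  then show ?thesis
    by (simp add: matrix_scale_mult_vec)
qed

lemma eigenspace_iff: "(M - mat c) *v v = 0 \<longleftrightarrow> M *v v = c *s v"
  for M :: "'a::field ^ 'n ^ 'n"
  by (simp only: matrix_vector_mult_diff_rdistrib mat_mult_vec right_minus_eq)

lemma Spec_iff: "c \<in> Spec M \<longleftrightarrow> (\<exists>v. v \<noteq> 0 \<and> M *v v = c *s v)"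
  for M :: "'a::field ^ 'n ^ 'n"
proof -
  have "c \<in> Spec M \<longleftrightarrow> \<not> (\<exists>B. B ** (M - mat c) = mat 1)"
    using invertible_det_nz[of "M - mat c"] by (auto simp: Spec_def invertible_left_inverse)
  then show ?thesis
    by (auto simp: matrix_left_invertible_ker eigenspace_iff)
qed

text \<open>A nonzero vector belongs to at most one eigenvalue, so the eigenvectors are the disjoint
  union of the eigenspaces without \<open>0\<close>.\<close>

lemma card_eigenvectors:
  fixes M :: "'a::{field,finite} ^ 'n ^ 'n"
  shows "card {v. eigenvector M v} = (\<Sum>c\<in>Spec M. CARD('a) ^ eigendim M c - 1)"
proof -
  let ?E = "\<lambda>c. {v. (M - mat c) *v v = 0} - {0}"
  have "{v. eigenvector M v} = (\<Union>c\<in>Spec M. ?E c)"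
    by (auto simp: eigenvector_def Spec_iff eigenspace_iff)
  moreover have "card (?E c) = CARD('a) ^ eigendim M c - 1" for c
  proof -
    have "vec.subspace {v. (M - mat c) *v v = 0}"
      by (intro vec.subspaceI)
         (auto simp: matrix_vector_right_distrib vector_scalar_commute simp del: diff_eq)
    then show ?thesis
      by (simp add: eigendim_def card_Diff_singleton vec.card_subspace)
  qed
  moreover have "?E c \<inter> ?E d = {}" if "c \<noteq> d" for c d
    using that by (auto simp: eigenspace_iff)
  then have "card (\<Union>c\<in>Spec M. ?E c) = (\<Sum>c\<in>Spec M. card (?E c))"
    by (intro card_UN_disjoint) auto
  ultimately show ?thesis
    by (simp only:)
qed

lemma card_eigenlines:
  fixes M :: "'a::{field,finite} ^ 'n ^ 'n"
  shows "(CARD('a) - 1) * card ((\<lambda>v. vec.span {v}) ` {v. eigenvector M v})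
    = card {v. eigenvector M v}"
proof (rule vec.card_lines_of_scaling_closed)
  fix c :: 'a and u :: "'a ^ 'n"
  assume u: "u \<in> {v. eigenvector M v}" and "c \<noteq> 0"
  then obtain d where "M *v u = d *s u"
    by (auto simp: eigenvector_def)
  then have "M *v (c *s u) = d *s (c *s u)"
    by (simp add: vector_scalar_commute mult.commute)
  then show "c *s u \<in> {v. eigenvector M v}"
    using u \<open>c \<noteq> 0\<close> by (auto simp: eigenvector_def)
qed (auto simp: eigenvector_def)

subsection \<open>Point vertices\<close>

text \<open>All fibres of the evaluation \<open>M \<mapsto> M *v v\<close> are translates of its kernel. Comparing the whole
  matrix space (the fibres above all vectors) with the fibres above the line through \<open>v\<close>
  eliminates the size of the kernel; the product form avoids a division.\<close>

lemma card_matrices_stabilizing_line: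
  fixes v :: "'a::{field,finite} ^ 'n"
  assumes "v \<noteq> 0"
  shows "CARD('a) ^ CARD('n) * card {M :: 'a ^ 'n ^ 'n. \<exists>c. M *v v = c *s v}
    = CARD('a) * CARD('a) ^ (CARD('n) * CARD('n))"
proof -
  let ?F = "\<lambda>w. {M :: 'a ^ 'n ^ 'n. M *v v = w}"
  obtain k where k: "v $ k \<noteq> 0"
    using assms by (auto simp: vec_eq_iff)
  have fib: "card (?F w) = card (?F 0)" for w
  proof -
    \<comment> \<open>A matrix sending \<open>v\<close> to \<open>w\<close>: only column \<open>k\<close>, where \<open>v\<close> does not vanish, is filled.\<close>
    define N :: "'a ^ 'n ^ 'n" where "N = (\<chi> i j. if j = k then w $ i / v $ k else 0)"
    have N: "N *v v = w"
      using k by (simp add: N_def matrix_vector_mult_def vec_eq_iff if_distrib[of "\<lambda>x. x * _"] cong: if_cong)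
    have "?F w = (+) N ` ?F 0"
    proof (intro equalityI subsetI)
      fix M assume "M \<in> ?F w"
      then show "M \<in> (+) N ` ?F 0"
        by (intro image_eqI[of _ _ "M - N"]) (auto simp: matrix_vector_mult_diff_rdistrib N)
    qed (auto simp: matrix_vector_mult_add_rdistrib N)
    then show ?thesis
      by (simp add: card_image)
  qed
  have un: "card (\<Union>w\<in>W. ?F w) = card W * card (?F 0)" for W
  proof -
    have "card (\<Union>w\<in>W. ?F w) = (\<Sum>w\<in>W. card (?F w))"
      by (rule card_UN_disjoint) auto
    also have "\<dots> = (\<Sum>w\<in>W. card (?F 0))"
      by (rule sum.cong[OF refl fib])
    finally show ?thesis
      by simp
  qed
  have "{M :: 'a ^ 'n ^ 'n. \<exists>c. M *v v = c *s v} = (\<Union>w\<in>vec.span {v}. ?F w)"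
    by (auto simp: vec.span_singleton)
  then have "card {M :: 'a ^ 'n ^ 'n. \<exists>c. M *v v = c *s v} = CARD('a) * card (?F 0)"
    by (simp only: un vec.card_span_singleton[OF assms])
  moreover have "(\<Union>w\<in>UNIV. ?F w) = UNIV"
    by auto
  then have "CARD('a ^ 'n ^ 'n) = CARD('a ^ 'n) * card (?F 0)"
    using un[of UNIV] by simp
  then have "CARD('a) ^ (CARD('n) * CARD('n)) = CARD('a) ^ CARD('n) * card (?F 0)"
    by (simp add: power_mult)
  ultimately show ?thesis
    by simp
qed

lemma card_matrices_with_eigenvector:
  fixes v :: "'a::{field,finite} ^ 'n"
  assumes "v \<noteq> 0"
  shows "card {M. M \<noteq> 0 \<and> eigenvector M v} = CARD('a) ^ (CARD('n)\<^sup>2 - CARD('n) + 1) - 1"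
proof -
  let ?W = "{M :: 'a ^ 'n ^ 'n. \<exists>c. M *v v = c *s v}"
  have "CARD('n) + (CARD('n)\<^sup>2 - CARD('n) + 1) = 1 + CARD('n) * CARD('n)"
    using le_square[of "CARD('n)"] by (simp add: power2_eq_square)
  then have "CARD('a) ^ CARD('n) * CARD('a) ^ (CARD('n)\<^sup>2 - CARD('n) + 1)
      = CARD('a) * CARD('a) ^ (CARD('n) * CARD('n))"
    by (metis power_add power_one_right)
  then have "CARD('a) ^ CARD('n) * card ?W
      = CARD('a) ^ CARD('n) * CARD('a) ^ (CARD('n)\<^sup>2 - CARD('n) + 1)"
    using card_matrices_stabilizing_line[OF assms] by simp
  then have "card ?W = CARD('a) ^ (CARD('n)\<^sup>2 - CARD('n) + 1)"
    by simp
  moreover have "{M. M \<noteq> 0 \<and> eigenvector M v} = ?W - {0}"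
    using assms by (auto simp: eigenvector_def)
  moreover have "0 \<in> ?W"
    by (auto intro!: exI[of _ 0])
  ultimately show ?thesis
    by (simp add: card_Diff_singleton)
qed

lemma card_matrix_lines_with_eigenvector:
  fixes v :: "'a::{field,finite} ^ 'n"
  shows "(CARD('a) - 1) * card ((\<lambda>M. matspace.span {M}) ` {M. M \<noteq> 0 \<and> eigenvector M v})
    = card {M. M \<noteq> 0 \<and> eigenvector M v}"
proof (rule matspace.card_lines_of_scaling_closed)
  fix c :: 'a and M :: "'a ^ 'n ^ 'n"
  assume M: "M \<in> {M. M \<noteq> 0 \<and> eigenvector M v}" and "c \<noteq> 0"
  then obtain d where "M *v v = d *s v"
    by (auto simp: eigenvector_def)
  then have "(c *\<^sub>M M) *v v = (c * d) *s v"
    by (simp add: matrix_scale_mult_vec)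
  then show "c *\<^sub>M M \<in> {M. M \<noteq> 0 \<and> eigenvector M v}"
    using M \<open>c \<noteq> 0\<close> by (auto simp: eigenvector_def)
qed auto

section \<open>A matrix with a single eigenline\<close>

text \<open>The witness is the shift \<open>x\<^sub>1, x\<^sub>2, \<dots>, x\<^sub>n \<mapsto> x\<^sub>2, \<dots>, x\<^sub>n, 0\<close>, written along an enumeration of
  the index type. A shift has no eigenvector for \<open>c \<noteq> 0\<close>, because the last coordinate must
  vanish and then, going backwards, every other one; its kernel is the first coordinate axis.
  Dimension at least two makes it nonzero.\<close>

lemma ex_matrix_unique_eigenline:
  assumes n: "CARD('n) \<ge> 2"
  obtains M :: "'a::field ^ 'n::finite ^ 'n" and w where "M \<noteq> 0" "eigenvector M w"
    and "\<And>v. eigenvector M v \<Longrightarrow> vec.span {v} = vec.span {w}"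
proof -
  obtain h :: "'n \<Rightarrow> nat" where h: "bij_betw h UNIV {0..<CARD('n)}"
    using ex_bij_betw_finite_nat[of "UNIV :: 'n set"] by auto
  have h_eq: "h i = h j \<longleftrightarrow> i = j" for i j
    using h by (auto simp: bij_betw_def inj_eq)
  have h_ex: "\<exists>i. h i = m" if "m < CARD('n)" for m
    using h that by (metis atLeastLessThan_iff bij_betw_iff_bijections le0)
  have h_less: "h i < CARD('n)" for i
    using h by (auto simp: bij_betw_def)
  define M :: "'a ^ 'n ^ 'n" where "M = (\<chi> i j. if h j = Suc (h i) then 1 else 0)"
  have shift: "(M *v x) $ i = x $ j" if "h j = Suc (h i)" for x i j
    using that
    by (simp add: M_def matrix_vector_mult_def if_distrib[of "\<lambda>x. x * _"] h_eq
        flip: that cong: if_cong)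
  have last: "(M *v x) $ i = 0" if "Suc (h i) = CARD('n)" for x i
    using that h_less[THEN less_imp_neq] by (simp add: M_def matrix_vector_mult_def)
  obtain i0 i1 where i: "h i0 = 0" "h i1 = 1"
    using h_ex[of 0] h_ex[of 1] n by auto
  let ?w = "axis i0 1 :: 'a ^ 'n"
  have "M $ i0 $ i1 = 1"
    by (simp add: M_def i)
  then have "M \<noteq> 0"
    by auto
  moreover have "M *v ?w = 0"
    using i by (auto simp: M_def matrix_vector_mult_def vec_eq_iff axis_def h_eq intro!: sum.neutral)
  then have "eigenvector M ?w"
    by (auto simp: eigenvector_def intro!: exI[of _ 0])
  moreover have "vec.span {v} = vec.span {?w}" if v: "eigenvector M v" for v
  proof -
    obtain c where "v \<noteq> 0" and c: "M *v v = c *s v"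
      using v by (auto simp: eigenvector_def)
    have "c = 0"
    proof (rule ccontr)
      assume "c \<noteq> 0"
      have "v $ i = 0" for i
      proof (induction "CARD('n) - h i" arbitrary: i rule: less_induct)
        case less
        have "(M *v v) $ i = 0"
        proof (cases "Suc (h i) = CARD('n)")
          case False
          then obtain j where j: "h j = Suc (h i)"
            using h_ex[of "Suc (h i)"] h_less[of i] by auto
          then have "v $ j = 0"
            using less[of j] h_less[of i] by simp
          then show ?thesis
            by (simp add: shift[OF j])
        qed (rule last)
        then show ?case
          using \<open>c \<noteq> 0\<close> by (simp add: c)
      qed
      then show False
        using \<open>v \<noteq> 0\<close> by (simp add: vec_eq_iff)
    qed
    have "v $ j = 0" if "j \<noteq> i0" for j
    proof -
      have "h j \<noteq> 0"
        using that i h_eq by metis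
      then have "h j = Suc (h j - 1)"
        by simp
      moreover obtain i where "h i = h j - 1"
        using h_ex[of "h j - 1"] h_less[of j] by (meson less_imp_diff_less)
      ultimately have "h j = Suc (h i)"
        by simp
      then show ?thesis
        using shift[of j i v] c \<open>c = 0\<close> by simp
    qed
    then have "v = v $ i0 *s ?w"
      by (simp add: vec_eq_iff axis_def)
    then have "v \<in> vec.span {?w}"
      by (metis rangeI vec.span_singleton)
    then show ?thesis
      using \<open>v \<noteq> 0\<close> by (rule vec.span_singleton_cong)
  qed
  ultimately show thesis
    by (rule that)
qed

section \<open>The degree formulas\<close>

theorem theorem1p10:
  fixes q n :: nat
  assumes q: "CARD('a::{field,finite}) = q"
    and n: "CARD('n::finite) = n" "n \<ge> 2"
  shows
    "(\<forall>M \<in> (eigmats :: ('a ^ 'n ^ 'n) set).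
        real (vdegree (SIG TYPE('a ^ 'n)) (Inl (matspace.span {M})))
          = (\<Sum>c \<in> Spec M. (real q ^ eigendim M c - 1) / (real q - 1))
      \<and> 1 \<le> real (vdegree (SIG TYPE('a ^ 'n)) (Inl (matspace.span {M})))
      \<and> real (vdegree (SIG TYPE('a ^ 'n)) (Inl (matspace.span {M})))
          \<le> (real q ^ n - 1) / (real q - 1))
   \<and> (\<forall>L \<in> (projspace :: ('a ^ 'n) set set).
        real (vdegree (SIG TYPE('a ^ 'n)) (Inr L))
          = (real q ^ (n\<^sup>2 - n + 1) - 1) / (real q - 1))
   \<and> real (max_degree (SIG TYPE('a ^ 'n))) = (real q ^ (n\<^sup>2 - n + 1) - 1) / (real q - 1)
   \<and> min_degree (SIG TYPE('a ^ 'n)) = 1"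
proof -
  let ?D = "vdegree (SIG TYPE('a ^ 'n))"
  let ?N = "(real q ^ (n\<^sup>2 - n + 1) - 1) / (real q - 1)"
  have "card {0, 1 :: 'a} \<le> CARD('a)"
    by (rule card_mono) auto
  then have q2: "q \<ge> 2"
    by (simp add: q)
  have quot: "real x = real y / (real q - 1)" if "(CARD('a) - 1) * x = y" for x y
    using that q2 by (auto simp: q field_simps)

  have matrix_deg: "real (?D (Inl (matspace.span {M}))) = real (card {v. eigenvector M v}) / (real q - 1)"
    if "M \<in> eigmats" for M :: "'a ^ 'n ^ 'n"
    using quot[OF card_eigenlines] by (simp add: vdegree_SIG_matrix[OF that])
  have A1: "real (?D (Inl (matspace.span {M})))
      = (\<Sum>c \<in> Spec M. (real q ^ eigendim M c - 1) / (real q - 1))"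
    if "M \<in> eigmats" for M :: "'a ^ 'n ^ 'n"
    using q2
    by (simp add: matrix_deg[OF that] card_eigenvectors q of_nat_diff flip: sum_divide_distrib)
  have A2: "1 \<le> ?D (Inl (matspace.span {M}))" if "M \<in> eigmats" for M :: "'a ^ 'n ^ 'n"
    using that by (auto simp: vdegree_SIG_matrix[OF that] Suc_le_eq card_gt_0_iff eigmats_def)
  have A2_real: "1 \<le> real (?D (Inl (matspace.span {M})))"
    if "M \<in> eigmats" for M :: "'a ^ 'n ^ 'n"
    using A2[OF that] by linarith
  have A3: "real (?D (Inl (matspace.span {M}))) \<le> (real q ^ n - 1) / (real q - 1)"
    if "M \<in> eigmats" for M :: "'a ^ 'n ^ 'n"
  proof -
    have "card {v. eigenvector M v} \<le> card (UNIV - {0 :: 'a ^ 'n})"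
      by (rule card_mono) (auto simp: eigenvector_def)
    also have "\<dots> = q ^ n - 1"
      by (simp add: card_Diff_singleton q n)
    finally have "real (card {v. eigenvector M v}) \<le> real (q ^ n - 1)"
      by simp
    also have "\<dots> = real q ^ n - 1"
      using q2 by (simp add: of_nat_diff)
    finally have "real (card {v. eigenvector M v}) \<le> real q ^ n - 1" .
    then show ?thesis
      using q2 by (simp add: matrix_deg[OF that] divide_right_mono)
  qed
  have B: "real (?D (Inr L)) = ?N" if L: "L \<in> projspace" for L :: "('a ^ 'n) set"
  proof -
    obtain v :: "'a ^ 'n" where v: "v \<noteq> 0" "L = vec.span {v}"
      using L by (auto simp: projspace_def)
    have "real (?D (Inr L)) = real (card {M. M \<noteq> 0 \<and> eigenvector M v}) / (real q - 1)"
      using quot[OF card_matrix_lines_with_eigenvector] by (simp add: v vdegree_SIG_point)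
    also have "\<dots> = ?N"
      using q2 by (simp add: card_matrices_with_eigenvector[OF v(1)] q n(1) of_nat_diff del: power_Suc)
    finally show ?thesis .
  qed

  have "n * 2 \<le> n * n"
    using n(2) by (rule mult_le_mono2)
  then have n_le: "n \<le> n\<^sup>2 - n + 1"
    unfolding power2_eq_square by linarith
  \<comment> \<open>Because of \<open>n \<le> n\<^sup>2 - n + 1\<close>, no matrix vertex exceeds the common degree of the points.\<close>
  have le: "(real q ^ n - 1) / (real q - 1) \<le> ?N"
    using q2 n_le by (intro divide_right_mono diff_right_mono power_increasing) auto
  have one_le: "1 \<le> ?N"
  proof -
    have "real q ^ 1 \<le> real q ^ (n\<^sup>2 - n + 1)"
      using q2 by (intro power_increasing) auto
    then show ?thesis
      using q2 by (simp add: field_simps)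
  qed
  have fin: "finite (?D ` fst (SIG TYPE('a ^ 'n)))"
    by (intro finite_imageI) (simp add: SIG_def)
  have vertices: "x \<in> fst (SIG TYPE('a ^ 'n)) \<longleftrightarrow>
      (\<exists>M\<in>eigmats. x = Inl (matspace.span {M})) \<or> (\<exists>L\<in>projspace. x = Inr L)" for x
    by (auto simp: SIG_def eiglines_def)

  have "vec.span {axis undefined 1 :: 'a ^ 'n} \<in> projspace"
    by (auto simp: projspace_def)
  then obtain L :: "('a ^ 'n) set" where L: "L \<in> projspace"
    by blast
  have "max_degree (SIG TYPE('a ^ 'n)) = ?D (Inr L)"
    unfolding max_degree_def
  proof (rule Max_eqI[OF fin])
    fix y assume "y \<in> ?D ` fst (SIG TYPE('a ^ 'n))"
    then obtain x where x: "x \<in> fst (SIG TYPE('a ^ 'n))" "y = ?D x"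
      by blast
    then have "real y \<le> ?N"
      using A3 B le by (auto simp: vertices intro: order_trans)
    then show "y \<le> ?D (Inr L)"
      using B[OF L] by linarith
  qed (use L vertices in blast)
  then have max: "real (max_degree (SIG TYPE('a ^ 'n))) = ?N"
    by (simp add: B[OF L])

  obtain M :: "'a ^ 'n ^ 'n" and w where M: "M \<noteq> 0" "eigenvector M w"
    and uniq: "\<And>v. eigenvector M v \<Longrightarrow> vec.span {v} = vec.span {w}"
    using ex_matrix_unique_eigenline n by metis
  have ME: "M \<in> eigmats"
    using M by (auto simp: eigmats_def)
  have "(\<lambda>v. vec.span {v}) ` {v. eigenvector M v} = {vec.span {w}}"
    by (intro equalityI subsetI) (use M(2) uniq in blast)+
  then have deg1: "?D (Inl (matspace.span {M})) = 1"
    by (simp add: vdegree_SIG_matrix[OF ME])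
  have min: "min_degree (SIG TYPE('a ^ 'n)) = 1"
    unfolding min_degree_def
  proof (rule Min_eqI[OF fin])
    fix y assume "y \<in> ?D ` fst (SIG TYPE('a ^ 'n))"
    then obtain x where x: "x \<in> fst (SIG TYPE('a ^ 'n))" "y = ?D x"
      by blast
    have "1 \<le> ?D (Inr L)" if "L \<in> projspace" for L :: "('a ^ 'n) set"
      using B[OF that] one_le by linarith
    then show "1 \<le> y"
      using x A2 unfolding vertices by blast
  next
    show "1 \<in> ?D ` fst (SIG TYPE('a ^ 'n))"
      using ME deg1 vertices by (metis image_eqI)
  qed
  show ?thesis
    by (intro conjI ballI A1 A3 B max min A2_real)
qed

end
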